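(* Let $\Gamma \subset \mathcal{H}_K^*$ and let $(\Lambda_n)_{n \in \mathbb{N}}$ be a nested sequence (i.e. $\Lambda_n \subset \Lambda_{n+1}$ for all $n$) of finite subsets of $\Gamma$. Then $$\| f - I_{K,\Lambda_n}(f) \|_{K} \xrightarrow{n \to \infty} 0 \qquad \text{for all } f \in \mathcal{H}_{K,\Gamma}$$ if and only if $$P_{\Lambda_n}(\lambda) \xrightarrow{n \to \infty} 0 \qquad \text{for all } \lambda \in \Gamma.$$
   Context: $K : \mathbb{R}^d \times \mathbb{R}^d \to \mathbb{R}$ is a positive definite function: $K$ is symmetric and for every finite set $\{x_1,\dots,x_n\}\subset\mathbb{R}^d$ of pairwise distinct points the matrix $(K(x_i,x_j))_{1\le i,j\le n}$ is symmetric positive definite. $\mathcal{H}_K$ is the reproducing kernel Hilbert space of real-valued functions on $\mathbb{R}^d$ generated by $K$, with norm $\|\cdot\|_K$; $\mathcal{H}_K^*$ is its (continuous) dual space. For $\lambda \in \mathcal{H}_K^*$, $\lambda^y K(\cdot,y)$ denotes the function $x \mapsto \lambda^y K(x,y)$ ($\lambda$ applied to $K(x,\cdot)$ as a function of $y$); it belongs to $\mathcal{H}_K$ and is the Riesz representer of $\lambda$, i.e. $\lambda(f) = \langle f, \lambda^y K(\cdot,y)\rangle_{\mathcal{H}_K}$ for all $f \in \mathcal{H}_K$. For a finite set $\Lambda = \{\lambda_1,\dots,\lambda_n\}\subset\mathcal{H}_K^*$, let $\mathcal{S}_{K,\Lambda} = \mathrm{span}\{\lambda_1^yK(\cdot,y),\dots,\lambda_n^yK(\cdot,y)\}$.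 For $f\in\mathcal{H}_K$, $I_{K,\Lambda}(f)$ is the unique $s\in\mathcal{S}_{K,\Lambda}$ with $\lambda_i(s)=\lambda_i(f)$ for all $i$; equivalently, $I_{K,\Lambda}$ is the orthogonal projection of $\mathcal{H}_K$ onto $\mathcal{S}_{K,\Lambda}$ (if the functionals are linearly dependent, redundant ones may be removed without changing $\mathcal{S}_{K,\Lambda}$ or the projection). For $\Gamma\subset\mathcal{H}_K^*$, $\mathcal{H}_{K,\Gamma}$ is the closure in $\mathcal{H}_K$ of $\mathrm{span}\{\lambda^yK(\cdot,y) \mid \lambda\in\Gamma\}$. The generalized power function of a finite set $\Lambda\subset\Gamma$ is $P_\Lambda(\lambda) = \|\lambda^yK(\cdot,y) - I_{K,\Lambda}(\lambda^yK(\cdot,y))\|_K$ for $\lambda\in\Gamma$. *)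

theory Defs
  imports "HOL-Analysis.Analysis" "HOL-Library.Function_Algebras"
begin

text \<open>Pointwise vector space structure on functions; addition comes from
  \<^theory>\<open>HOL-Library.Function_Algebras\<close>.\<close>

instantiation "fun" :: (type, real_vector) real_vector
begin

definition scaleR_fun_def: "c *\<^sub>R f = (\<lambda>x. c *\<^sub>R f x)"

instance
  by standard (simp_all add: scaleR_fun_def plus_fun_def scaleR_add_right scaleR_add_left)

end

lemma scaleR_fun_apply [simp]: "(c *\<^sub>R f) x = c *\<^sub>R f x"
  by (simp add: scaleR_fun_def)

text \<open>Matrices indexed by a finite set of pairwise distinct points are indexed here by the set
  itself.\<close>

definition positive_definite_kernel :: "('x \<Rightarrow> 'x \<Rightarrow> real) \<Rightarrow> bool" where
  "positive_definite_kernel K \<longleftrightarrow>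
     (\<forall>x y. K x y = K y x) \<and>
     (\<forall>X c. finite X \<longrightarrow> (\<exists>x\<in>X. c x \<noteq> 0) \<longrightarrow> (\<Sum>x\<in>X. \<Sum>y\<in>X. c x * c y * K x y) > 0)"

text \<open>An inner product on a linear subspace \<open>H\<close>; the values of \<open>ip\<close> outside \<open>H\<close> are irrelevant.\<close>

locale inner_product_on =
  fixes H :: "'v::real_vector set" and ip :: "'v \<Rightarrow> 'v \<Rightarrow> real"
  assumes subspace: "subspace H"
    and ip_commute: "\<lbrakk>f \<in> H; g \<in> H\<rbrakk> \<Longrightarrow> ip f g = ip g f"
    and ip_add_left: "\<lbrakk>f \<in> H; g \<in> H; h \<in> H\<rbrakk> \<Longrightarrow> ip (f + g) h = ip f h + ip g h"
    and ip_scaleR_left: "\<lbrakk>f \<in> H; g \<in> H\<rbrakk> \<Longrightarrow> ip (c *\<^sub>R f) g = c * ip f g"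
    and ip_nonneg: "f \<in> H \<Longrightarrow> 0 \<le> ip f f"
    and ip_eq_zero: "f \<in> H \<Longrightarrow> ip f f = 0 \<Longrightarrow> f = 0"

definition ip_norm :: "('v \<Rightarrow> 'v \<Rightarrow> real) \<Rightarrow> 'v \<Rightarrow> real" where
  "ip_norm ip f = sqrt (ip f f)"

text \<open>The guard is needed because \<^locale>\<open>Metric_space\<close> demands a nonnegative symmetric distance
  on the whole type.\<close>

definition ip_dist :: "'v::real_vector set \<Rightarrow> ('v \<Rightarrow> 'v \<Rightarrow> real) \<Rightarrow> 'v \<Rightarrow> 'v \<Rightarrow> real" where
  "ip_dist H ip f g = (if f \<in> H \<and> g \<in> H then ip_norm ip (f - g) else 0)"

context inner_product_on
begin

lemma ip_add_right: "\<lbrakk>f \<in> H; g \<in> H; h \<in> H\<rbrakk> \<Longrightarrow> ip h (f + g) = ip h f + ip h g"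
  using ip_add_left ip_commute subspace subspace_add by metis

lemma ip_scaleR_right: "\<lbrakk>f \<in> H; g \<in> H\<rbrakk> \<Longrightarrow> ip g (c *\<^sub>R f) = c * ip g f"
  using ip_scaleR_left ip_commute subspace subspace_scale by metis

lemma ip_expand:
  assumes "f \<in> H" "g \<in> H"
  shows "ip (f + c *\<^sub>R g) (f + c *\<^sub>R g) = ip f f + 2 * c * ip f g + c\<^sup>2 * ip g g"
proof -
  have cg: "c *\<^sub>R g \<in> H" and fcg: "f + c *\<^sub>R g \<in> H"
    using assms subspace by (auto simp: subspace_add subspace_scale)
  show ?thesis
    using assms cg fcg ip_commute[OF assms]
    by (simp add: ip_add_left ip_add_right ip_scaleR_left ip_scaleR_right power2_eq_square
        algebra_simps)
qed

lemma Cauchy_Schwarz: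
  assumes f: "f \<in> H" and g: "g \<in> H"
  shows "ip f g \<le> ip_norm ip f * ip_norm ip g"
proof (cases "ip g g = 0")
  case True
  have "g = 0 *\<^sub>R f" using ip_eq_zero[OF g True] by simp
  then have "ip f g = 0" using ip_scaleR_right[OF f f, of 0] by simp
  then show ?thesis using f g by (simp add: ip_norm_def ip_nonneg)
next
  case False
  then have pos: "0 < ip g g" using ip_nonneg[OF g] by simp
  define c where "c = - ip f g / ip g g"
  have "f + c *\<^sub>R g \<in> H" using f g subspace by (simp add: subspace_add subspace_scale)
  then have "0 \<le> ip f f + 2 * c * ip f g + c\<^sup>2 * ip g g"
    using ip_nonneg ip_expand[OF f g] by metis
  also have "\<dots> = ip f f - (ip f g)\<^sup>2 / ip g g"
    using pos by (simp add: c_def power2_eq_square field_simps)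
  finally have "(ip f g)\<^sup>2 \<le> ip f f * ip g g" using pos by (simp add: field_simps)
  then show ?thesis
    unfolding ip_norm_def real_sqrt_mult[symmetric] by (rule real_le_rsqrt)
qed

lemma norm_triangle:
  assumes f: "f \<in> H" and g: "g \<in> H"
  shows "ip_norm ip (f + g) \<le> ip_norm ip f + ip_norm ip g"
proof -
  have sq: "(ip_norm ip h)\<^sup>2 = ip h h" if "h \<in> H" for h
    using that by (simp add: ip_norm_def ip_nonneg)
  have "(ip_norm ip (f + g))\<^sup>2 = ip f f + 2 * ip f g + ip g g"
    using sq[of "f + g"] ip_expand[OF f g, of 1] f g subspace by (simp add: subspace_add)
  also have "\<dots> \<le> (ip_norm ip f + ip_norm ip g)\<^sup>2"
    using Cauchy_Schwarz[OF f g] sq f g by (simp add: power2_sum)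
  finally show ?thesis
    by (rule power2_le_imp_le) (simp add: f g ip_nonneg ip_norm_def)
qed

lemma norm_minus:
  assumes "f \<in> H" "g \<in> H"
  shows "ip_norm ip (f - g) = ip_norm ip (g - f)"
proof -
  have d: "g - f \<in> H" using assms subspace by (simp add: subspace_diff)
  then have "- 1 *\<^sub>R (g - f) \<in> H" by (rule subspace_scale[OF subspace])
  then show ?thesis
    using ip_scaleR_left[OF d, of "- 1 *\<^sub>R (g - f)" "- 1"] ip_scaleR_right[OF d d, of "- 1"]
    by (simp add: ip_norm_def)
qed

sublocale Met: Metric_space H "ip_dist H ip"
proof
  show "0 \<le> ip_dist H ip f g" for f g
    using subspace by (simp add: ip_dist_def ip_norm_def ip_nonneg subspace_diff)
  show "ip_dist H ip f g = ip_dist H ip g f" for f g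
    using norm_minus by (auto simp: ip_dist_def)
  show "ip_dist H ip f g = 0 \<longleftrightarrow> f = g" if "f \<in> H" "g \<in> H" for f g
  proof -
    have "ip 0 0 = 0"
      using ip_scaleR_left[of 0 0 0] subspace_0[OF subspace] by simp
    then show ?thesis
      using that ip_eq_zero[of "f - g"] subspace
      by (auto simp: ip_dist_def ip_norm_def subspace_diff)
  qed
  show "ip_dist H ip f h \<le> ip_dist H ip f g + ip_dist H ip g h"
    if "f \<in> H" "g \<in> H" "h \<in> H" for f g h
    using norm_triangle[of "f - g" "g - h"] that subspace
    by (simp add: ip_dist_def subspace_diff)
qed

end

locale hilbert_space_on = inner_product_on +
  assumes complete: "Met.mcomplete"

text \<open>\<open>(H, ip)\<close> is the reproducing kernel Hilbert space of \<open>K\<close>: a Hilbert space of functions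
  (with the pointwise operations) which contains all \<open>K x\<close>, that is \<open>K(x, \<cdot>)\<close>, and in which these
  represent the point evaluations.\<close>

locale rkhs = hilbert_space_on H ip
  for K :: "'x \<Rightarrow> 'x \<Rightarrow> real" and H :: "('x \<Rightarrow> real) set"
    and ip :: "('x \<Rightarrow> real) \<Rightarrow> ('x \<Rightarrow> real) \<Rightarrow> real" +
  assumes kernel_in: "K x \<in> H"
    and reproducing: "f \<in> H \<Longrightarrow> f x = ip f (K x)"

text \<open>Functionals on \<open>H\<close> are made extensional, so that equality of functionals is equality on
  \<open>H\<close>.\<close>

definition dual_space :: "'v::real_vector set \<Rightarrow> ('v \<Rightarrow> 'v \<Rightarrow> real) \<Rightarrow> ('v \<Rightarrow> real) set" where
  "dual_space H ip = {\<phi> \<in> extensional H.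
     (\<forall>f\<in>H. \<forall>g\<in>H. \<phi> (f + g) = \<phi> f + \<phi> g) \<and>
     (\<forall>c. \<forall>f\<in>H. \<phi> (c *\<^sub>R f) = c * \<phi> f) \<and>
     (\<exists>B. \<forall>f\<in>H. \<bar>\<phi> f\<bar> \<le> B * ip_norm ip f)}"

text \<open>The function \<open>\<lambda>\<^sup>y K(\<cdot>, y)\<close>.\<close>

definition kernel_rep :: "('x \<Rightarrow> 'x \<Rightarrow> real) \<Rightarrow> (('x \<Rightarrow> real) \<Rightarrow> real) \<Rightarrow> 'x \<Rightarrow> real" where
  "kernel_rep K \<phi> = (\<lambda>x. \<phi> (\<lambda>y. K x y))"

definition interp_space ::
    "('x \<Rightarrow> 'x \<Rightarrow> real) \<Rightarrow> (('x \<Rightarrow> real) \<Rightarrow> real) set \<Rightarrow> ('x \<Rightarrow> real) set" where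
  "interp_space K \<Lambda> = span (kernel_rep K ` \<Lambda>)"

text \<open>Interpolation conditions coming from linearly dependent functionals are consistent, so the
  interpolant is well defined for every finite \<open>\<Lambda>\<close> in the dual.\<close>

definition interpolant ::
    "('x \<Rightarrow> 'x \<Rightarrow> real) \<Rightarrow> (('x \<Rightarrow> real) \<Rightarrow> real) set \<Rightarrow> ('x \<Rightarrow> real) \<Rightarrow> 'x \<Rightarrow> real" where
  "interpolant K \<Lambda> f = (THE s. s \<in> interp_space K \<Lambda> \<and> (\<forall>\<phi>\<in>\<Lambda>. \<phi> s = \<phi> f))"

definition native_closure ::
    "('x \<Rightarrow> 'x \<Rightarrow> real) \<Rightarrow> ('x \<Rightarrow> real) set \<Rightarrow> (('x \<Rightarrow> real) \<Rightarrow> ('x \<Rightarrow> real) \<Rightarrow> real) \<Rightarrow>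
     (('x \<Rightarrow> real) \<Rightarrow> real) set \<Rightarrow> ('x \<Rightarrow> real) set" where
  "native_closure K H ip \<Gamma> =
     Metric_space.mtopology H (ip_dist H ip) closure_of span (kernel_rep K ` \<Gamma>)"

definition power_function ::
    "('x \<Rightarrow> 'x \<Rightarrow> real) \<Rightarrow> (('x \<Rightarrow> real) \<Rightarrow> ('x \<Rightarrow> real) \<Rightarrow> real) \<Rightarrow>
     (('x \<Rightarrow> real) \<Rightarrow> real) set \<Rightarrow> (('x \<Rightarrow> real) \<Rightarrow> real) \<Rightarrow> real" where
  "power_function K ip \<Lambda> \<phi> =
     ip_norm ip (kernel_rep K \<phi> - interpolant K \<Lambda> (kernel_rep K \<phi>))"

end

theory Submission
  imports Defs
begin

text \<open>The interpolant of \<open>f\<close> is the orthogonal projection of \<open>f\<close> onto the span of the Riesz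
  representers of \<open>\<Lambda>\<close>, hence the best approximation of \<open>f\<close> from that span. The power function at
  \<open>\<phi>\<close> is the interpolation error of one particular element of the native closure,
  the representer of \<open>\<phi>\<close>, so the forward implication is an instantiation.

  For the converse, the elements whose best approximation errors tend to \<open>0\<close> form a closed linear
  subspace (\<open>best_approximation_errors_subspace\<close>, \<open>best_approximation_errors_closed\<close>). This subspace
  contains the representers of \<open>\<Gamma>\<close>, hence also the closure of their span.

  The identification of interpolation with projection needs the function \<open>kernel_rep K \<phi>\<close> to
  represent \<open>\<phi>\<close>. The Riesz representation theorem, proved by a variational argument, gives some
  representer, and the reproducing property shows that its values are those of \<open>kernel_rep K \<phi>\<close>.\<close>

section \<open>Orthogonal projections onto finite spans\<close>

definition orthogonal_projection ::
    "('v::real_vector \<Rightarrow> 'v \<Rightarrow> real) \<Rightarrow> 'v set \<Rightarrow> 'v \<Rightarrow> 'v \<Rightarrow> bool" where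
  "orthogonal_projection ip A f s \<longleftrightarrow> s \<in> span A \<and> (\<forall>a\<in>A. ip (f - s) a = 0)"

context inner_product_on
begin

lemma span_subset_H: "A \<subseteq> H \<Longrightarrow> span A \<subseteq> H"
  by (rule span_minimal[OF _ subspace])

lemma ip_diff_left: "\<lbrakk>f \<in> H; g \<in> H; h \<in> H\<rbrakk> \<Longrightarrow> ip (f - g) h = ip f h - ip g h"
  using ip_add_left[of "f - g" g h] subspace_diff[OF subspace, of f g] by simp

lemma ip_zero_right: "f \<in> H \<Longrightarrow> ip f 0 = 0"
  using ip_scaleR_right[of f f 0] by simp

lemma norm_sq: "f \<in> H \<Longrightarrow> (ip_norm ip f)\<^sup>2 = ip f f"
  by (simp add: ip_norm_def ip_nonneg)

lemma norm_nonneg: "f \<in> H \<Longrightarrow> 0 \<le> ip_norm ip f"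
  by (simp add: ip_norm_def ip_nonneg)

lemma norm_scaleR: "f \<in> H \<Longrightarrow> ip_norm ip (c *\<^sub>R f) = \<bar>c\<bar> * ip_norm ip f"
  using ip_scaleR_left[of f "c *\<^sub>R f" c] ip_scaleR_right[of f f c] subspace_scale[OF subspace, of f c]
  by (simp add: ip_norm_def real_sqrt_mult mult.assoc[symmetric])

lemma abs_ip_le:
  assumes "f \<in> H" "g \<in> H"
  shows "\<bar>ip f g\<bar> \<le> ip_norm ip f * ip_norm ip g"
proof -
  have "ip (- 1 *\<^sub>R f) g \<le> ip_norm ip (- 1 *\<^sub>R f) * ip_norm ip g"
    using assms by (intro Cauchy_Schwarz subspace_scale[OF subspace])
  then show ?thesis
    using Cauchy_Schwarz[OF assms] ip_scaleR_left[OF assms, of "- 1"]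
      norm_scaleR[OF assms(1), of "- 1"] by simp
qed

lemma orthogonal_to_span:
  assumes "A \<subseteq> H" "f \<in> H" "\<And>a. a \<in> A \<Longrightarrow> ip f a = 0" "v \<in> span A"
  shows "ip f v = 0"
proof -
  have "subspace {v \<in> H. ip f v = 0}"
    using subspace assms(2)
    by (auto intro!: subspaceI simp: subspace_0 subspace_add subspace_scale ip_add_right
        ip_scaleR_right ip_zero_right)
  then have "span A \<subseteq> {v \<in> H. ip f v = 0}"
    using assms by (intro span_minimal) auto
  then show ?thesis using assms(4) by auto
qed

text \<open>The induction performs one Gram--Schmidt step at a time: the projection onto the span of \<open>insert a A\<close> adds to the
  projection onto the span of \<open>A\<close> a multiple of the component of \<open>a\<close> orthogonal to \<open>A\<close>.\<close>

lemma orthogonal_projection_exists: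
  assumes "finite A" "A \<subseteq> H" "f \<in> H"
  shows "\<exists>s. orthogonal_projection ip A f s"
  using assms
proof (induction A arbitrary: f)
  case empty
  then show ?case by (auto simp: orthogonal_projection_def)
next
  case (insert a A)
  obtain s where s: "s \<in> span A" "\<And>b. b \<in> A \<Longrightarrow> ip (f - s) b = 0"
    using insert.IH[of f] insert.prems by (auto simp: orthogonal_projection_def)
  obtain p where p: "p \<in> span A" "\<And>b. b \<in> A \<Longrightarrow> ip (a - p) b = 0"
    using insert.IH[of a] insert.prems by (auto simp: orthogonal_projection_def)
  have AH: "A \<subseteq> H" and aH: "a \<in> H" and fH: "f \<in> H" using insert.prems by auto
  have sH: "s \<in> H" and pH: "p \<in> H" using s p span_subset_H[OF AH] by auto
  define e where "e = a - p"
  define r where "r = f - s"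
  (* If e = 0, then c = 0 by the convention for division, and the old projection is the new one. *)
  define c where "c = ip r e / ip e e"
  have eH: "e \<in> H" and rH: "r \<in> H" and ceH: "c *\<^sub>R e \<in> H"
    using aH pH fH sH subspace by (auto simp: e_def r_def subspace_diff subspace_scale)
  have res: "f - (s + c *\<^sub>R e) = r - c *\<^sub>R e" by (simp add: r_def)
  have orth_A: "ip (r - c *\<^sub>R e) b = 0" if "b \<in> A" for b
  proof -
    have "b \<in> H" using that AH by auto
    then show ?thesis
      using s(2)[OF that] p(2)[OF that] eH rH ceH
      by (simp add: ip_diff_left ip_scaleR_left) (simp add: r_def e_def)
  qed
  have orth_e: "ip (r - c *\<^sub>R e) e = 0"
    using eH rH ceH ip_eq_zero[OF eH] ip_zero_right[OF rH]
    by (cases "ip e e = 0") (auto simp: ip_diff_left ip_scaleR_left c_def)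
  have resH: "r - c *\<^sub>R e \<in> H" using rH ceH subspace by (simp add: subspace_diff)
  have "ip (r - c *\<^sub>R e) p = 0"
    by (rule orthogonal_to_span[OF AH resH orth_A p(1)])
  then have orth_a: "ip (r - c *\<^sub>R e) a = 0"
    using orth_e ip_add_right[OF eH pH resH] by (simp add: e_def)
  have sub: "span A \<subseteq> span (insert a A)" by (rule span_mono) auto
  have "s + c *\<^sub>R e \<in> span (insert a A)"
    unfolding e_def using s(1) p(1) sub
    by (intro span_add span_scale span_diff) (auto intro: span_base)
  then have "orthogonal_projection ip (insert a A) f (s + c *\<^sub>R e)"
    using orth_A orth_a unfolding orthogonal_projection_def res by blast
  then show ?case ..
qed

lemma orthogonal_projection_unique:
  assumes "A \<subseteq> H" "f \<in> H" "orthogonal_projection ip A f s" "orthogonal_projection ip A f t"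
  shows "s = t"
proof -
  have sH: "s \<in> H" and tH: "t \<in> H" and d: "s - t \<in> span A"
    using assms span_subset_H[OF assms(1)] by (auto simp: orthogonal_projection_def span_diff)
  then have dH: "s - t \<in> H" using span_subset_H[OF assms(1)] by auto
  have "ip (s - t) a = 0" if "a \<in> A" for a
  proof -
    have aH: "a \<in> H" using that assms(1) by auto
    have "ip (f - s) a = 0" "ip (f - t) a = 0"
      using assms(3,4) that by (auto simp: orthogonal_projection_def)
    then show ?thesis using aH sH tH assms(2) by (simp add: ip_diff_left)
  qed
  then have "ip (s - t) (s - t) = 0"
    by (rule orthogonal_to_span[OF assms(1) dH _ d])
  then show ?thesis using ip_eq_zero[OF dH] by simp
qed

text \<open>The residual \<open>f - s\<close> is orthogonal to \<open>s - t\<close>, so by Pythagoras replacing \<open>s\<close> by \<open>t\<close> can only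
  lengthen it.\<close>

lemma orthogonal_projection_best:
  assumes "A \<subseteq> H" "f \<in> H" "orthogonal_projection ip A f s" "t \<in> span A"
  shows "ip_norm ip (f - s) \<le> ip_norm ip (f - t)"
proof -
  have sH: "s \<in> H" and d: "s - t \<in> span A"
    using assms span_subset_H[OF assms(1)] by (auto simp: orthogonal_projection_def span_diff)
  have dH: "s - t \<in> H" and rH: "f - s \<in> H"
    using d span_subset_H[OF assms(1)] sH assms(2) subspace by (auto simp: subspace_diff)
  have "ip (f - s) (s - t) = 0"
    using assms(3) by (intro orthogonal_to_span[OF assms(1) rH _ d]) (auto simp: orthogonal_projection_def)
  then have "ip (f - t) (f - t) = ip (f - s) (f - s) + ip (s - t) (s - t)"
    using ip_expand[OF rH dH, of 1] by simp
  then show ?thesis using ip_nonneg[OF dH] by (simp add: ip_norm_def)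
qed

end

section \<open>Convergence of best approximations\<close>

text \<open>A choice \<open>P n\<close> of best approximations may be nonlinear, but its errors are distances to the
  subspaces \<open>V n\<close>; these are subadditive and absolutely homogeneous, which suffices for convergence.\<close>

locale best_approximations = inner_product_on H ip
  for H :: "'v::real_vector set" and ip :: "'v \<Rightarrow> 'v \<Rightarrow> real" +
  fixes V :: "nat \<Rightarrow> 'v set" and P :: "nat \<Rightarrow> 'v \<Rightarrow> 'v"
  assumes V_subspace: "subspace (V n)"
    and V_subset: "V n \<subseteq> H"
    and P_in: "f \<in> H \<Longrightarrow> P n f \<in> V n"
    and P_best: "\<lbrakk>f \<in> H; t \<in> V n\<rbrakk> \<Longrightarrow> ip_norm ip (f - P n f) \<le> ip_norm ip (f - t)"
begin

lemma residual_in: "f \<in> H \<Longrightarrow> f - P n f \<in> H"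
  using P_in V_subset subspace_diff[OF subspace] by blast

lemma error_nonneg: "f \<in> H \<Longrightarrow> 0 \<le> ip_norm ip (f - P n f)"
  by (rule norm_nonneg[OF residual_in])

lemma error_add_le:
  assumes "f \<in> H" "g \<in> H"
  shows "ip_norm ip ((f + g) - P n (f + g)) \<le> ip_norm ip (f - P n f) + ip_norm ip (g - P n g)"
proof -
  have "ip_norm ip ((f + g) - P n (f + g)) \<le> ip_norm ip ((f + g) - (P n f + P n g))"
    using assms P_in by (intro P_best subspace_add[OF subspace] subspace_add[OF V_subspace])
  also have "(f + g) - (P n f + P n g) = (f - P n f) + (g - P n g)" by simp
  also have "ip_norm ip \<dots> \<le> ip_norm ip (f - P n f) + ip_norm ip (g - P n g)"
    using assms by (intro norm_triangle residual_in)
  finally show ?thesis .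
qed

lemma error_scaleR_le:
  assumes "f \<in> H"
  shows "ip_norm ip (c *\<^sub>R f - P n (c *\<^sub>R f)) \<le> \<bar>c\<bar> * ip_norm ip (f - P n f)"
proof -
  have "ip_norm ip (c *\<^sub>R f - P n (c *\<^sub>R f)) \<le> ip_norm ip (c *\<^sub>R f - c *\<^sub>R P n f)"
    using assms P_in by (intro P_best subspace_scale[OF subspace] subspace_scale[OF V_subspace])
  also have "c *\<^sub>R f - c *\<^sub>R P n f = c *\<^sub>R (f - P n f)" by (simp add: scaleR_diff_right)
  also have "ip_norm ip \<dots> = \<bar>c\<bar> * ip_norm ip (f - P n f)"
    by (rule norm_scaleR[OF residual_in[OF assms]])
  finally show ?thesis .
qed

lemma error_perturb_le:
  assumes "f \<in> H" "g \<in> H"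
  shows "ip_norm ip (f - P n f) \<le> ip_norm ip (f - g) + ip_norm ip (g - P n g)"
proof -
  have "ip_norm ip (f - P n f) \<le> ip_norm ip ((f - g) + (g - P n g))"
    using P_best[OF assms(1) P_in[OF assms(2)]] by simp
  also have "\<dots> \<le> ip_norm ip (f - g) + ip_norm ip (g - P n g)"
    using assms subspace_diff[OF subspace] by (intro norm_triangle residual_in)
  finally show ?thesis .
qed

lemma best_approximation_errors_subspace:
  "subspace {f \<in> H. (\<lambda>n. ip_norm ip (f - P n f)) \<longlonglongrightarrow> 0}"
proof (rule subspaceI)
  have 0: "0 \<in> H" by (rule subspace_0[OF subspace])
  have "ip_norm ip (0 - P n 0) = 0" for n
    using error_scaleR_le[OF 0, of 0 n] error_nonneg[OF 0, of n] by simp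
  then show "0 \<in> {f \<in> H. (\<lambda>n. ip_norm ip (f - P n f)) \<longlonglongrightarrow> 0}"
    using 0 by simp
next
  fix f g
  assume fg: "f \<in> {f \<in> H. (\<lambda>n. ip_norm ip (f - P n f)) \<longlonglongrightarrow> 0}"
    "g \<in> {f \<in> H. (\<lambda>n. ip_norm ip (f - P n f)) \<longlonglongrightarrow> 0}"
  then have "f + g \<in> H" by (simp add: subspace_add[OF subspace])
  moreover have "(\<lambda>n. ip_norm ip ((f + g) - P n (f + g))) \<longlonglongrightarrow> 0"
  proof (rule tendsto_sandwich[OF _ _ tendsto_const])
    show "(\<lambda>n. ip_norm ip (f - P n f) + ip_norm ip (g - P n g)) \<longlonglongrightarrow> 0"
      using fg by (auto intro: tendsto_add_zero)
  qed (use fg error_add_le error_nonneg[OF \<open>f + g \<in> H\<close>] in auto)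
  ultimately show "f + g \<in> {f \<in> H. (\<lambda>n. ip_norm ip (f - P n f)) \<longlonglongrightarrow> 0}" by simp
next
  fix c f
  assume f: "f \<in> {f \<in> H. (\<lambda>n. ip_norm ip (f - P n f)) \<longlonglongrightarrow> 0}"
  then have "c *\<^sub>R f \<in> H" by (simp add: subspace_scale[OF subspace])
  moreover have "(\<lambda>n. ip_norm ip (c *\<^sub>R f - P n (c *\<^sub>R f))) \<longlonglongrightarrow> 0"
  proof (rule tendsto_sandwich[OF _ _ tendsto_const])
    show "(\<lambda>n. \<bar>c\<bar> * ip_norm ip (f - P n f)) \<longlonglongrightarrow> 0"
      using f by (auto intro: tendsto_mult_right_zero)
  qed (use f error_scaleR_le error_nonneg[OF \<open>c *\<^sub>R f \<in> H\<close>] in auto)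
  ultimately show "c *\<^sub>R f \<in> {f \<in> H. (\<lambda>n. ip_norm ip (f - P n f)) \<longlonglongrightarrow> 0}" by simp
qed

text \<open>An error changes by at most \<open>ip_norm ip (f - g)\<close> when \<open>f\<close> is replaced by \<open>g\<close>, uniformly in \<open>n\<close>,
  so convergence passes to limits.\<close>

lemma best_approximation_errors_closed:
  assumes S: "\<And>g. g \<in> S \<Longrightarrow> (\<lambda>n. ip_norm ip (g - P n g)) \<longlonglongrightarrow> 0"
    and f: "f \<in> Met.mtopology closure_of S"
  shows "(\<lambda>n. ip_norm ip (f - P n f)) \<longlonglongrightarrow> 0"
proof (rule LIMSEQ_I)
  fix \<epsilon> :: real assume "0 < \<epsilon>"
  then have "0 < \<epsilon> / 2" by simp
  then obtain g where g: "g \<in> S" "f \<in> H" "g \<in> H" "ip_norm ip (f - g) < \<epsilon> / 2"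
    using f unfolding Met.metric_closure_of by (fastforce simp: ip_dist_def)
  obtain N where N: "\<And>n. n \<ge> N \<Longrightarrow> norm (ip_norm ip (g - P n g) - 0) < \<epsilon> / 2"
    using LIMSEQ_D[OF S[OF g(1)] \<open>0 < \<epsilon> / 2\<close>] by blast
  have "norm (ip_norm ip (f - P n f) - 0) < \<epsilon>" if "n \<ge> N" for n
    using N[OF that] error_perturb_le[OF g(2,3), of n] g(4) error_nonneg[OF g(2), of n] by simp
  then show "\<exists>N. \<forall>n\<ge>N. norm (ip_norm ip (f - P n f) - 0) < \<epsilon>" by blast
qed

end

section \<open>Riesz representation\<close>

text \<open>The representer of \<open>\<phi>\<close> is the minimiser of \<open>J f = ip f f - 2 * \<phi> f\<close>, which is the squared distance
  to the representer up to a constant. The parallelogram law makes every minimising sequence Cauchy.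
  The first variation of \<open>J\<close> along the sequence tends to \<open>0\<close>, so in the limit \<open>\<phi> g = ip g u\<close>.\<close>

theorem (in hilbert_space_on) Riesz_representation:
  assumes "\<phi> \<in> dual_space H ip"
  obtains u where "u \<in> H" "\<And>g. g \<in> H \<Longrightarrow> \<phi> g = ip g u"
proof -
  have add: "\<phi> (f + g) = \<phi> f + \<phi> g" if "f \<in> H" "g \<in> H" for f g
    using assms that by (simp add: dual_space_def)
  have scale: "\<phi> (c *\<^sub>R f) = c * \<phi> f" if "f \<in> H" for c f
    using assms that by (simp add: dual_space_def)
  have "\<exists>B. \<forall>f\<in>H. \<bar>\<phi> f\<bar> \<le> B * ip_norm ip f"
    using assms by (simp add: dual_space_def)
  then obtain B where B: "\<And>f. f \<in> H \<Longrightarrow> \<bar>\<phi> f\<bar> \<le> B * ip_norm ip f" by blast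
  define J where "J f = ip f f - 2 * \<phi> f" for f
  have J_lower: "- B\<^sup>2 \<le> J f" if "f \<in> H" for f
  proof -
    have "0 \<le> (ip_norm ip f - B)\<^sup>2" by simp
    then show ?thesis
      using B[OF that] norm_sq[OF that] by (simp add: J_def power2_diff algebra_simps)
  qed
  define m where "m = (INF f\<in>H. J f)"
  have bdd: "bdd_below (J ` H)" by (rule bdd_belowI2[OF J_lower])
  have m_le: "m \<le> J f" if "f \<in> H" for f
    unfolding m_def by (rule cINF_lower[OF bdd that])
  have "\<exists>f\<in>H. J f < m + inverse (Suc n)" for n
    using cINF_less_iff[OF _ bdd, of "m + inverse (Suc n)"] subspace_0[OF subspace]
    by (fastforce simp: m_def)
  then obtain F where F: "\<And>n. F n \<in> H" "\<And>n. J (F n) < m + inverse (Suc n)" by metis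
  have scaled: "c *\<^sub>R g \<in> H" "f + c *\<^sub>R g \<in> H" if "f \<in> H" "g \<in> H" for c f g
    using that subspace by (auto simp: subspace_add subspace_scale)
  have J_expand: "J (f + c *\<^sub>R g) = J f + 2 * c * (ip f g - \<phi> g) + c\<^sup>2 * ip g g"
    if "f \<in> H" "g \<in> H" for f g c
    using that scaled[OF that] by (simp add: J_def ip_expand add scale algebra_simps)
  (* Parallelogram law: compare the value of J at the midpoint f + d/2 with its lower bound m. *)
  have gap: "ip (f - g) (f - g) \<le> 2 * (J f - m) + 2 * (J g - m)" if "f \<in> H" "g \<in> H" for f g
  proof -
    define d where "d = g - f"
    have dH: "d \<in> H" using that subspace by (simp add: d_def subspace_diff)
    have "J g = J f + 2 * (ip f d - \<phi> d) + ip d d"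
      using J_expand[OF that(1) dH, of 1] by (simp add: d_def)
    moreover have "m \<le> J f + (ip f d - \<phi> d) + ip d d / 4"
      using J_expand[OF that(1) dH, of "1/2"] m_le[OF scaled(2)[OF that(1) dH, of "1/2"]]
      by (simp add: power2_eq_square)
    moreover have "ip (f - g) (f - g) = ip d d"
      using norm_minus[OF that] by (simp add: ip_norm_def d_def)
    ultimately show ?thesis by argo
  qed
  have "Met.MCauchy F"
    unfolding Met.MCauchy_def
  proof (intro conjI allI impI)
    show "range F \<subseteq> H" using F(1) by auto
    fix \<epsilon> :: real assume \<epsilon>: "0 < \<epsilon>"
    then obtain N where N: "inverse (real (Suc N)) < \<epsilon>\<^sup>2 / 4"
      using reals_Archimedean[of "\<epsilon>\<^sup>2 / 4"] by auto
    have "ip_dist H ip (F i) (F j) < \<epsilon>" if "N \<le> i" "N \<le> j" for i j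
    proof -
      have small: "J (F k) - m < \<epsilon>\<^sup>2 / 4" if "N \<le> k" for k
      proof -
        have "inverse (real (Suc k)) \<le> inverse (real (Suc N))"
          using that by (intro le_imp_inverse_le) auto
        then show ?thesis using F(2)[of k] N by linarith
      qed
      have "ip (F i - F j) (F i - F j) < \<epsilon>\<^sup>2"
        using gap[OF F(1) F(1), of i j] small[OF that(1)] small[OF that(2)] by argo
      then show ?thesis
        using \<epsilon> F(1) by (simp add: ip_dist_def ip_norm_def real_less_lsqrt)
    qed
    then show "\<exists>N. \<forall>n n'. N \<le> n \<longrightarrow> N \<le> n' \<longrightarrow> ip_dist H ip (F n) (F n') < \<epsilon>" by blast
  qed
  then obtain u where u: "limitin Met.mtopology F u sequentially"
    using complete unfolding Met.mcomplete_def by blast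
  then have uH: "u \<in> H" and ulim: "(\<lambda>n. ip_dist H ip (F n) u) \<longlonglongrightarrow> 0"
    by (auto simp: Met.limitin_metric_dist_null)
  have ulim': "(\<lambda>n. ip_norm ip (F n - u)) \<longlonglongrightarrow> 0"
    using ulim F(1) uH by (simp add: ip_dist_def)
  have "\<phi> g = ip g u" if gH: "g \<in> H" for g
  proof (cases "ip g g = 0")
    case True
    then have "g = 0" by (rule ip_eq_zero[OF gH])
    then show ?thesis
      using scale[OF uH, of 0] ip_scaleR_left[OF uH uH, of 0] by simp
  next
    case False
    then have q: "0 < ip g g" using ip_nonneg[OF gH] by simp
    (* J along the line through F n in direction g stays above m;
       evaluating it at the vertex of this parabola bounds the slope. *)
    have slope: "(ip (F n) g - \<phi> g)\<^sup>2 \<le> ip g g * inverse (Suc n)" for n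
    proof -
      define a where "a = ip (F n) g - \<phi> g"
      have "m \<le> J (F n) + 2 * (- a / ip g g) * a + (- a / ip g g)\<^sup>2 * ip g g"
        using J_expand[OF F(1) gH, of n "- a / ip g g"] m_le[OF scaled(2)[OF F(1) gH]]
        unfolding a_def by metis
      also have "\<dots> = J (F n) - a\<^sup>2 / ip g g"
        using q by (simp add: power2_eq_square field_simps)
      finally have "a\<^sup>2 / ip g g \<le> inverse (Suc n)" using F(2)[of n] by linarith
      then show ?thesis using q by (simp add: a_def pos_divide_le_eq mult.commute)
    qed
    have "(\<lambda>n. ip g g * inverse (real (Suc n))) \<longlonglongrightarrow> 0"
      by (intro tendsto_mult_right_zero LIMSEQ_inverse_real_of_nat)
    then have "(\<lambda>n. (ip (F n) g - \<phi> g)\<^sup>2) \<longlonglongrightarrow> 0"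
      by (rule tendsto_sandwich[OF _ _ tendsto_const, rotated 2]) (use slope in auto)
    then have "(\<lambda>n. ip (F n) g - \<phi> g) \<longlonglongrightarrow> 0" by simp
    then have lim_\<phi>: "(\<lambda>n. ip (F n) g) \<longlonglongrightarrow> \<phi> g" by (simp add: LIM_zero_iff)
    have "(\<lambda>n. ip_norm ip (F n - u) * ip_norm ip g) \<longlonglongrightarrow> 0"
      by (intro tendsto_mult_left_zero ulim')
    moreover have "norm (ip (F n) g - ip u g) \<le> ip_norm ip (F n - u) * ip_norm ip g" for n
      using abs_ip_le[of "F n - u" g] F(1)[of n] uH gH subspace
      by (simp add: ip_diff_left subspace_diff)
    ultimately have "(\<lambda>n. ip (F n) g - ip u g) \<longlonglongrightarrow> 0"
      using Lim_null_comparison by (metis (no_types, lifting) always_eventually)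
    then have "(\<lambda>n. ip (F n) g) \<longlonglongrightarrow> ip u g" by (simp add: LIM_zero_iff)
    then show ?thesis
      using LIMSEQ_unique[OF lim_\<phi>] ip_commute[OF uH gH] by simp
  qed
  with uH that show thesis by blast
qed

section \<open>Generalized interpolation as projection\<close>

context rkhs
begin

text \<open>Evaluating the representer \<open>u\<close> at \<open>x\<close> means pairing it with \<open>K x\<close>, which gives \<open>\<phi> (K x)\<close>.\<close>

lemma kernel_rep_represents:
  assumes "\<phi> \<in> dual_space H ip"
  shows "kernel_rep K \<phi> \<in> H" and "f \<in> H \<Longrightarrow> \<phi> f = ip f (kernel_rep K \<phi>)"
proof -
  obtain u where u: "u \<in> H" "\<And>g. g \<in> H \<Longrightarrow> \<phi> g = ip g u"
    using Riesz_representation[OF assms] by blast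
  have "kernel_rep K \<phi> = u"
    using u kernel_in reproducing ip_commute by (auto simp: kernel_rep_def fun_eq_iff)
  then show "kernel_rep K \<phi> \<in> H" and "f \<in> H \<Longrightarrow> \<phi> f = ip f (kernel_rep K \<phi>)"
    using u by auto
qed

lemma kernel_rep_subset: "\<Lambda> \<subseteq> dual_space H ip \<Longrightarrow> kernel_rep K ` \<Lambda> \<subseteq> H"
  using kernel_rep_represents(1) by blast

text \<open>The interpolation conditions say precisely that the residual is orthogonal to the representers.\<close>

lemma interpolant_orthogonal_projection:
  assumes fin: "finite \<Lambda>" and dual: "\<Lambda> \<subseteq> dual_space H ip" and f: "f \<in> H"
  shows "orthogonal_projection ip (kernel_rep K ` \<Lambda>) f (interpolant K \<Lambda> f)"
proof -
  let ?A = "kernel_rep K ` \<Lambda>"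
  have A: "?A \<subseteq> H" by (rule kernel_rep_subset[OF dual])
  have "(\<phi> s = \<phi> f) = (ip (f - s) (kernel_rep K \<phi>) = 0)" if "\<phi> \<in> \<Lambda>" "s \<in> H" for \<phi> s
    using that f dual kernel_rep_represents[of \<phi>] by (auto simp: ip_diff_left subset_iff)
  then have iff: "s \<in> interp_space K \<Lambda> \<and> (\<forall>\<phi>\<in>\<Lambda>. \<phi> s = \<phi> f) \<longleftrightarrow> orthogonal_projection ip ?A f s" for s
    using span_subset_H[OF A] by (auto simp: orthogonal_projection_def interp_space_def)
  have "\<exists>!s. orthogonal_projection ip ?A f s"
    using orthogonal_projection_exists[OF _ A f] orthogonal_projection_unique[OF A f] fin by blast
  then show ?thesis
    unfolding interpolant_def iff by (rule theI')
qed

lemma interpolants_best_approximations: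
  assumes "\<And>n. finite (\<Lambda> n)" "\<And>n. \<Lambda> n \<subseteq> dual_space H ip"
  shows "best_approximations H ip (\<lambda>n. interp_space K (\<Lambda> n)) (\<lambda>n. interpolant K (\<Lambda> n))"
proof
  fix n f t
  have A: "kernel_rep K ` \<Lambda> n \<subseteq> H" by (rule kernel_rep_subset[OF assms(2)])
  show "subspace (interp_space K (\<Lambda> n))" by (simp add: interp_space_def)
  show "interp_space K (\<Lambda> n) \<subseteq> H"
    unfolding interp_space_def by (rule span_subset_H[OF A])
  show "interpolant K (\<Lambda> n) f \<in> interp_space K (\<Lambda> n)" if "f \<in> H"
    using interpolant_orthogonal_projection[OF assms that]
    by (simp add: orthogonal_projection_def interp_space_def)
  show "ip_norm ip (f - interpolant K (\<Lambda> n) f) \<le> ip_norm ip (f - t)"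
    if "f \<in> H" "t \<in> interp_space K (\<Lambda> n)"
    using orthogonal_projection_best[OF A that(1) interpolant_orthogonal_projection[OF assms that(1)]]
      that(2) by (simp add: interp_space_def)
qed

end

section \<open>Convergence criterion\<close>

theorem theorem3p1:
  fixes K :: "real ^ 'd \<Rightarrow> real ^ 'd \<Rightarrow> real"
    and H :: "(real ^ 'd \<Rightarrow> real) set"
    and ip :: "(real ^ 'd \<Rightarrow> real) \<Rightarrow> (real ^ 'd \<Rightarrow> real) \<Rightarrow> real"
    and \<Gamma> :: "((real ^ 'd \<Rightarrow> real) \<Rightarrow> real) set"
    and \<Lambda> :: "nat \<Rightarrow> ((real ^ 'd \<Rightarrow> real) \<Rightarrow> real) set"
  assumes "positive_definite_kernel K"
    and "rkhs K H ip"
    and "\<Gamma> \<subseteq> dual_space H ip"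
    and "\<And>n. finite (\<Lambda> n)"
    and "\<And>n. \<Lambda> n \<subseteq> \<Gamma>"
    and "\<And>n. \<Lambda> n \<subseteq> \<Lambda> (Suc n)"
  shows "(\<forall>f \<in> native_closure K H ip \<Gamma>.
            (\<lambda>n. ip_norm ip (f - interpolant K (\<Lambda> n) f)) \<longlonglongrightarrow> 0) \<longleftrightarrow>
         (\<forall>\<phi> \<in> \<Gamma>. (\<lambda>n. power_function K ip (\<Lambda> n) \<phi>) \<longlonglongrightarrow> 0)"
proof -
  interpret rkhs K H ip by fact
  have dual: "\<Lambda> n \<subseteq> dual_space H ip" for n using assms(3,5) by blast
  interpret best_approximations H ip "\<lambda>n. interp_space K (\<Lambda> n)" "\<lambda>n. interpolant K (\<Lambda> n)"
    by (rule interpolants_best_approximations[OF assms(4) dual])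
  let ?R = "kernel_rep K ` \<Gamma>"
  let ?G = "{f \<in> H. (\<lambda>n. ip_norm ip (f - interpolant K (\<Lambda> n) f)) \<longlonglongrightarrow> 0}"
  have R: "?R \<subseteq> H" by (rule kernel_rep_subset[OF assms(3)])
  show ?thesis
  proof (intro iffI ballI)
    fix \<phi>
    assume conv: "\<forall>f \<in> native_closure K H ip \<Gamma>.
      (\<lambda>n. ip_norm ip (f - interpolant K (\<Lambda> n) f)) \<longlonglongrightarrow> 0" and \<phi>: "\<phi> \<in> \<Gamma>"
    have "span ?R \<subseteq> native_closure K H ip \<Gamma>"
      unfolding native_closure_def using span_subset_H[OF R] by (intro closure_of_subset) simp
    then have "kernel_rep K \<phi> \<in> native_closure K H ip \<Gamma>"
      using \<phi> span_base[of "kernel_rep K \<phi>" ?R] by auto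
    then show "(\<lambda>n. power_function K ip (\<Lambda> n) \<phi>) \<longlonglongrightarrow> 0"
      using conv by (simp add: power_function_def)
  next
    fix f
    assume "\<forall>\<phi> \<in> \<Gamma>. (\<lambda>n. power_function K ip (\<Lambda> n) \<phi>) \<longlonglongrightarrow> 0"
      and f: "f \<in> native_closure K H ip \<Gamma>"
    then have "?R \<subseteq> ?G" using R by (auto simp: power_function_def)
    then have "span ?R \<subseteq> ?G"
      by (rule span_minimal[OF _ best_approximation_errors_subspace])
    then have "(\<lambda>n. ip_norm ip (g - interpolant K (\<Lambda> n) g)) \<longlonglongrightarrow> 0" if "g \<in> span ?R" for g
      using that by auto
    then show "(\<lambda>n. ip_norm ip (f - interpolant K (\<Lambda> n) f)) \<longlonglongrightarrow> 0"
      using f unfolding native_closure_def by (rule best_approximation_errors_closed)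
  qed
qed

end
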